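(* Let $\mathcal{F}$ be a Fraïssé structure in a relational language such that $\mathcal{F}$ has the Henson property and the Hrushovski property, and such that $\mathrm{Age}(\mathcal{F})$ has the free joint embedding property. Let $G=\mathrm{Aut}(\mathcal{F})$ with the topology of pointwise convergence. Then every tame $G$-flow has a fixed point. Equivalently, the universal minimal tame flow $M_t(G)$ is a singleton.
   Context: A Fraïssé structure is a countable structure $\mathcal{F}$ in a relational language which is ultrahomogeneous (every isomorphism between finite substructures extends to an automorphism of $\mathcal{F}$); $\mathrm{Age}(\mathcal{F})$ is the class of finite structures embeddable in $\mathcal{F}$. For structures $A,B$, $A\sqcup B$ is the structure on the disjoint union with no relations other than those of $A$ and those of $B$; $\mathrm{Age}(\mathcal{F})$ has the free joint embedding property if $A\sqcup B\in\mathrm{Age}(\mathcal{F})$ for all $A,B\in\mathrm{Age}(\mathcal{F})$. $\mathcal{F}$ has the Henson property if for every countable structure $A$ embeddable in $\mathcal{F}$ there is an embedding $h\colon A\to\mathcal{F}$ such that every automorphism of the substructure $h(A)$ extends to an automorphism of $\mathcal{F}$. $\mathcal{F}$ has the Hrushovski property if for every $A\in\mathrm{Age}(\mathcal{F})$ there are $B\in\mathrm{Age}(\mathcal{F})$ and an embedding $h\colon A\to B$ such that every partial isomorphism between substructures of $h(A)$ extends to an automorphism of $B$. A $G$-flow is a compact Hausdorff space $X$ with a continuous $G$-action. For $A_0,A_1\subseteq X$, an independence set for $\{A_0,A_1\}$ is a set $I\subseteq G$ such that for every finite $J\subseteq I$ and every $\sigma\colon J\to\{0,1\}$, $\bigcap_{j\in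 J}j^{-1}A_{\sigma(j)}\neq\varnothing$. A pair $(x,y)\in X^2$ is an IT-pair if for all neighbourhoods $U_0\ni x$, $U_1\ni y$, $\{U_0,U_1\}$ has an infinite independence set. A $G$-flow is tame if there is no continuous $f\colon X\to\mathbb R$ and IT-pair $(x,y)$ with $x\neq y$ and $f(x)\neq f(y)$. $M_t(G)$ is the universal minimal tame $G$-flow (a minimal tame flow having every minimal tame flow as an equivariant continuous image; unique up to isomorphism). *)

theory Defs
  imports "HOL-Analysis.Analysis" "HOL-Algebra.Group_Action"
begin

text \<open>A relational language is given by the type of its symbols together with an arity
  function. All notions below are invariant under isomorphism, so wherever a
  definition ranges over finite or countable structures it suffices to let the universe
  be a set of natural numbers.\<close>

record ('a, 'r) relstruct =
  universe :: "'a set"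
  interp :: "'r \<Rightarrow> 'a list set"

definition is_relstruct :: "('r \<Rightarrow> nat) \<Rightarrow> ('a, 'r) relstruct \<Rightarrow> bool" where
  "is_relstruct ar A \<longleftrightarrow>
     (\<forall>R. interp A R \<subseteq> {xs. length xs = ar R \<and> set xs \<subseteq> universe A})"

definition induced :: "('a, 'r) relstruct \<Rightarrow> 'a set \<Rightarrow> ('a, 'r) relstruct" where
  "induced A S = \<lparr>universe = S, interp = (\<lambda>R. {xs \<in> interp A R. set xs \<subseteq> S})\<rparr>"

definition embedding :: "('a, 'r) relstruct \<Rightarrow> ('b, 'r) relstruct \<Rightarrow> ('a \<Rightarrow> 'b) \<Rightarrow> bool" where
  "embedding A B h \<longleftrightarrow>
     inj_on h (universe A) \<and> h ` universe A \<subseteq> universe B \<and>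
     (\<forall>R. \<forall>xs \<in> lists (universe A). xs \<in> interp A R \<longleftrightarrow> map h xs \<in> interp B R)"

definition isomorphism :: "('a, 'r) relstruct \<Rightarrow> ('b, 'r) relstruct \<Rightarrow> ('a \<Rightarrow> 'b) \<Rightarrow> bool" where
  "isomorphism A B h \<longleftrightarrow> embedding A B h \<and> h ` universe A = universe B"

text \<open>As in \<^const>\<open>BijGroup\<close>, automorphisms are extensional functions, so that distinct
  elements of the set differ at some point of the universe.\<close>

definition automorphisms :: "('a, 'r) relstruct \<Rightarrow> ('a \<Rightarrow> 'a) set" where
  "automorphisms A = {g \<in> Bij (universe A). isomorphism A A g}"

definition aut_group :: "('a, 'r) relstruct \<Rightarrow> ('a \<Rightarrow> 'a) monoid" where
  "aut_group A = (BijGroup (universe A))\<lparr>carrier := automorphisms A\<rparr>"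

definition aut_topology :: "('a, 'r) relstruct \<Rightarrow> ('a \<Rightarrow> 'a) topology" where
  "aut_topology A =
     subtopology (product_topology (\<lambda>_. discrete_topology (universe A)) (universe A))
       (automorphisms A)"

definition disjoint_sum ::
  "('a, 'r) relstruct \<Rightarrow> ('b, 'r) relstruct \<Rightarrow> ('a + 'b, 'r) relstruct" where
  "disjoint_sum A B =
     \<lparr>universe = universe A <+> universe B,
      interp = (\<lambda>R. map Inl ` interp A R \<union> map Inr ` interp B R)\<rparr>"

definition in_age :: "('r \<Rightarrow> nat) \<Rightarrow> ('a, 'r) relstruct \<Rightarrow> ('b, 'r) relstruct \<Rightarrow> bool" where
  "in_age ar F A \<longleftrightarrow> is_relstruct ar A \<and> finite (universe A) \<and> (\<exists>h. embedding A F h)"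

definition ultrahomogeneous :: "('a, 'r) relstruct \<Rightarrow> bool" where
  "ultrahomogeneous F \<longleftrightarrow>
     (\<forall>S T p. finite S \<and> S \<subseteq> universe F \<and> finite T \<and> T \<subseteq> universe F \<and>
        isomorphism (induced F S) (induced F T) p \<longrightarrow>
        (\<exists>g \<in> automorphisms F. \<forall>x \<in> S. g x = p x))"

definition fraisse_structure :: "('r \<Rightarrow> nat) \<Rightarrow> ('a, 'r) relstruct \<Rightarrow> bool" where
  "fraisse_structure ar F \<longleftrightarrow>
     is_relstruct ar F \<and> countable (universe F) \<and> ultrahomogeneous F"

definition free_joint_embedding :: "('r \<Rightarrow> nat) \<Rightarrow> ('a, 'r) relstruct \<Rightarrow> bool" where
  "free_joint_embedding ar F \<longleftrightarrow>
     (\<forall>(A :: (nat, 'r) relstruct) (B :: (nat, 'r) relstruct).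
        in_age ar F A \<and> in_age ar F B \<longrightarrow> in_age ar F (disjoint_sum A B))"

definition henson_property :: "('r \<Rightarrow> nat) \<Rightarrow> ('a, 'r) relstruct \<Rightarrow> bool" where
  "henson_property ar F \<longleftrightarrow>
     (\<forall>A :: (nat, 'r) relstruct.
        is_relstruct ar A \<and> (\<exists>e. embedding A F e) \<longrightarrow>
        (\<exists>h. embedding A F h \<and>
           (\<forall>g \<in> automorphisms (induced F (h ` universe A)).
              \<exists>g' \<in> automorphisms F. \<forall>x \<in> h ` universe A. g' x = g x)))"

definition hrushovski_property :: "('r \<Rightarrow> nat) \<Rightarrow> ('a, 'r) relstruct \<Rightarrow> bool" where
  "hrushovski_property ar F \<longleftrightarrow>
     (\<forall>A :: (nat, 'r) relstruct. in_age ar F A \<longrightarrow>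
        (\<exists>(B :: (nat, 'r) relstruct) h. in_age ar F B \<and> embedding A B h \<and>
           (\<forall>S T p. S \<subseteq> h ` universe A \<and> T \<subseteq> h ` universe A \<and>
              isomorphism (induced B S) (induced B T) p \<longrightarrow>
              (\<exists>g \<in> automorphisms B. \<forall>x \<in> S. g x = p x))))"

text \<open>Flows of a group \<open>G\<close> carrying the topology \<open>T\<close>. Flows are nonempty, since otherwise
  the empty flow would be tame without a fixed point.\<close>

definition flow ::
  "('g, 'm) monoid_scheme \<Rightarrow> 'g topology \<Rightarrow> 'x topology \<Rightarrow> ('g \<Rightarrow> 'x \<Rightarrow> 'x) \<Rightarrow> bool" where
  "flow G T X \<phi> \<longleftrightarrow>
     topspace X \<noteq> {} \<and> compact_space X \<and> Hausdorff_space X \<and>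
     group_action G (topspace X) \<phi> \<and>
     continuous_map (prod_topology T X) X (\<lambda>(g, x). \<phi> g x)"

definition independence_set ::
  "('g, 'm) monoid_scheme \<Rightarrow> 'x topology \<Rightarrow> ('g \<Rightarrow> 'x \<Rightarrow> 'x) \<Rightarrow> 'x set \<Rightarrow> 'x set \<Rightarrow> 'g set \<Rightarrow> bool"
  where
  "independence_set G X \<phi> A0 A1 I \<longleftrightarrow>
     I \<subseteq> carrier G \<and>
     (\<forall>J (\<sigma> :: 'g \<Rightarrow> bool). finite J \<and> J \<subseteq> I \<longrightarrow>
        topspace X \<inter> (\<Inter>j\<in>J. \<phi> (inv\<^bsub>G\<^esub> j) ` (if \<sigma> j then A1 else A0)) \<noteq> {})"

definition neighbourhood :: "'x topology \<Rightarrow> 'x \<Rightarrow> 'x set \<Rightarrow> bool" where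
  "neighbourhood X x U \<longleftrightarrow> U \<subseteq> topspace X \<and> (\<exists>V. openin X V \<and> x \<in> V \<and> V \<subseteq> U)"

definition IT_pair ::
  "('g, 'm) monoid_scheme \<Rightarrow> 'x topology \<Rightarrow> ('g \<Rightarrow> 'x \<Rightarrow> 'x) \<Rightarrow> 'x \<Rightarrow> 'x \<Rightarrow> bool" where
  "IT_pair G X \<phi> x y \<longleftrightarrow>
     x \<in> topspace X \<and> y \<in> topspace X \<and>
     (\<forall>U0 U1. neighbourhood X x U0 \<and> neighbourhood X y U1 \<longrightarrow>
        (\<exists>I. infinite I \<and> independence_set G X \<phi> U0 U1 I))"

definition tame_flow ::
  "('g, 'm) monoid_scheme \<Rightarrow> 'g topology \<Rightarrow> 'x topology \<Rightarrow> ('g \<Rightarrow> 'x \<Rightarrow> 'x) \<Rightarrow> bool" where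
  "tame_flow G T X \<phi> \<longleftrightarrow>
     flow G T X \<phi> \<and>
     \<not> (\<exists>(f :: 'x \<Rightarrow> real) x y. continuous_map X euclideanreal f \<and>
          IT_pair G X \<phi> x y \<and> x \<noteq> y \<and> f x \<noteq> f y)"

definition minimal_flow ::
  "('g, 'm) monoid_scheme \<Rightarrow> 'g topology \<Rightarrow> 'x topology \<Rightarrow> ('g \<Rightarrow> 'x \<Rightarrow> 'x) \<Rightarrow> bool" where
  "minimal_flow G T X \<phi> \<longleftrightarrow>
     flow G T X \<phi> \<and>
     (\<forall>C. closedin X C \<and> C \<noteq> {} \<and> (\<forall>g \<in> carrier G. \<phi> g ` C \<subseteq> C) \<longrightarrow> C = topspace X)"

definition flow_image ::
  "('g, 'm) monoid_scheme \<Rightarrow> 'x topology \<Rightarrow> ('g \<Rightarrow> 'x \<Rightarrow> 'x) \<Rightarrow>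
     'y topology \<Rightarrow> ('g \<Rightarrow> 'y \<Rightarrow> 'y) \<Rightarrow> bool" where
  "flow_image G X \<phi> Y \<psi> \<longleftrightarrow>
     (\<exists>\<pi>. continuous_map X Y \<pi> \<and> \<pi> ` topspace X = topspace Y \<and>
        (\<forall>g \<in> carrier G. \<forall>x \<in> topspace X. \<pi> (\<phi> g x) = \<psi> g (\<pi> x)))"

text \<open>The type \<open>'y\<close> is the universe from which the points of the competing minimal tame flows
  are drawn, as one cannot quantify over types inside a definition. For \<open>G\<close> separable a
  minimal flow is a separable Hausdorff space and so has at most as many points as
  \<^typ>\<open>nat set set\<close>; hence \<open>'y = nat set set\<close> captures all of them up to isomorphism.\<close>

definition universal_minimal_tame_flow ::
  "'y itself \<Rightarrow> ('g, 'm) monoid_scheme \<Rightarrow> 'g topology \<Rightarrow>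
     'x topology \<Rightarrow> ('g \<Rightarrow> 'x \<Rightarrow> 'x) \<Rightarrow> bool" where
  "universal_minimal_tame_flow _ G T X \<phi> \<longleftrightarrow>
     minimal_flow G T X \<phi> \<and> tame_flow G T X \<phi> \<and>
     (\<forall>(Y :: 'y topology) \<psi>. minimal_flow G T Y \<psi> \<and> tame_flow G T Y \<psi> \<longrightarrow>
        flow_image G X \<phi> Y \<psi>)"

end

theory Submission imports Defs begin

text \<open>Suppose a tame flow \<open>X\<close> has no fixed point. Every \<open>y\<close> is moved by some \<open>g\<close>, and as \<open>(y, g y)\<close>
  is not an IT-pair, there are neighbourhoods \<open>V\<close> of \<open>y\<close> and \<open>V'\<close> of \<open>g y\<close> without an infinite
  independence set. By continuity \<open>v z \<in> V\<close> and \<open>v (g z) \<in> V'\<close> for all \<open>z\<close> near \<open>y\<close> and all \<open>v\<close> fixing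
  some finite set pointwise, and by compactness finitely many such data, with a common finite set
  \<open>D\<close>, cover \<open>X\<close>. Let \<open>C\<close> contain \<open>D\<close> and its translates under the inverses of the elements \<open>g\<close>
  involved. Free joint embedding, the Henson and the Hrushovski property yield \<open>u\<^sub>n \<in> G\<close> and, for every
  \<open>\<sigma>\<close>, some \<open>k\<^sub>\<sigma> \<in> G\<close> such that \<open>k\<^sub>\<sigma> u\<^sub>n\<close> agrees on \<open>D\<close> with \<open>u\<^sub>n\<close> or with \<open>u\<^sub>n g\<^sup>-\<^sup>1\<close>, as prescribed by
  \<open>\<sigma> n\<close>. For fixed \<open>x\<close>, infinitely many points \<open>u\<^sub>n\<^sup>-\<^sup>1 x\<close> lie in one member of the cover, so
  \<open>u\<^sub>n\<^sup>-\<^sup>1 (k\<^sub>\<sigma>\<^sup>-\<^sup>1 x)\<close> lies in \<open>V\<close> or \<open>V'\<close> according to \<open>\<sigma> n\<close>, and these \<open>u\<^sub>n\<^sup>-\<^sup>1\<close> form an infinite independence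
  set for \<open>{V, V'}\<close>.\<close>

section \<open>Embeddings, isomorphisms and induced substructures\<close>

lemma embedding_cong:
  assumes "embedding A B h" "\<And>x. x \<in> universe A \<Longrightarrow> h x = k x"
  shows "embedding A B k"
proof -
  have "xs \<in> interp A R \<longleftrightarrow> map k xs \<in> interp B R" if "xs \<in> lists (universe A)" for xs R
  proof -
    have eq: "map k xs = map h xs"
      using that assms(2) by (auto intro!: map_cong)
    show ?thesis
      unfolding eq using that assms(1) by (simp add: embedding_def)
  qed
  moreover have "inj_on k (universe A)" "k ` universe A \<subseteq> universe B"
    using assms unfolding embedding_def by (auto simp: inj_on_def)
  ultimately show ?thesis
    unfolding embedding_def by blast
qed

lemma embedding_compose:
  assumes "embedding A B h" "embedding B C k"
  shows "embedding A C (k \<circ> h)"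
proof -
  have "map h xs \<in> lists (universe B)" if "xs \<in> lists (universe A)" for xs
    using that assms(1) unfolding embedding_def by (auto simp: image_subset_iff)
  moreover have "inj_on (k \<circ> h) (universe A)"
    using assms unfolding embedding_def by (meson comp_inj_on inj_on_subset)
  ultimately show ?thesis
    using assms unfolding embedding_def by (auto simp: image_subset_iff simp flip: map_map)
qed

lemma universe_induced [simp]: "universe (induced A S) = S"
  by (simp add: induced_def)

lemma induced_induced: "T \<subseteq> S \<Longrightarrow> induced (induced A S) T = induced A T"
  by (auto simp: induced_def)

lemma embedding_induced: "S \<subseteq> universe A \<Longrightarrow> embedding (induced A S) A id"
  by (auto simp: embedding_def induced_def)

lemma embedding_restrict:
  assumes "embedding A B h" "S \<subseteq> universe A"
  shows "embedding (induced A S) B h"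
  using embedding_compose[OF embedding_induced[OF assms(2)] assms(1)] by simp

lemma is_relstruct_induced: "is_relstruct ar A \<Longrightarrow> is_relstruct ar (induced A S)"
  by (auto simp: is_relstruct_def induced_def)

lemma isomorphism_onto_image:
  assumes "embedding A B h"
  shows "isomorphism A (induced B (h ` universe A)) h"
  using assms by (auto simp: isomorphism_def embedding_def induced_def)

lemma isomorphism_inverse:
  assumes "isomorphism A B h"
  shows "isomorphism B A (inv_into (universe A) h)"
proof -
  let ?i = "inv_into (universe A) h"
  have h: "inj_on h (universe A)" "h ` universe A = universe B"
    "\<And>R xs. xs \<in> lists (universe A) \<Longrightarrow> xs \<in> interp A R \<longleftrightarrow> map h xs \<in> interp B R"
    using assms by (auto simp: isomorphism_def embedding_def)
  have img: "?i ` universe B = universe A"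
    using h by (metis inv_into_image_cancel subset_refl)
  have "xs \<in> interp B R \<longleftrightarrow> map ?i xs \<in> interp A R" if xs: "xs \<in> lists (universe B)" for xs R
  proof -
    have "map ?i xs \<in> lists (universe A)"
      using xs h(2) by (auto intro!: inv_into_into)
    moreover have "map h (map ?i xs) = xs"
      using xs h(2) by (intro map_idI[of xs "h \<circ> ?i", simplified map_map[symmetric]])
        (auto simp: f_inv_into_f)
    ultimately show ?thesis
      using h(3) by metis
  qed
  moreover have "inj_on ?i (universe B)"
    using h(2) by (simp add: inj_on_inv_into)
  ultimately show ?thesis
    using img by (auto simp: isomorphism_def embedding_def)
qed

lemma isomorphism_compose:
  assumes "isomorphism A B h" "isomorphism B C k"
  shows "isomorphism A C (k \<circ> h)"
proof -
  have "(k \<circ> h) ` universe A = k ` h ` universe A"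
    by (rule image_comp[symmetric])
  then show ?thesis
    using assms embedding_compose[of A B h C k] by (simp only: isomorphism_def)
qed

lemma isomorphism_cong:
  assumes "isomorphism A B h" "\<And>x. x \<in> universe A \<Longrightarrow> h x = k x"
  shows "isomorphism A B k"
  using assms embedding_cong[of A B h k] by (auto simp: isomorphism_def)

text \<open>Conjugation by \<open>h\<close> carries partial isomorphisms inside \<open>A\<close> to
  partial isomorphisms inside its image, where the Hrushovski property can extend them. The inverse
  is taken on \<open>S\<close> alone, the universe of the restricted source.\<close>

lemma isomorphism_embedding_image:
  assumes "embedding A B h" "S \<subseteq> universe A" "T \<subseteq> universe A"
    and "isomorphism (induced A S) (induced A T) p"
  shows "isomorphism (induced B (h ` S)) (induced B (h ` T)) (h \<circ> p \<circ> inv_into S h)"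
proof -
  have "isomorphism (induced A S') (induced B (h ` S')) h" if "S' \<subseteq> universe A" for S'
    using isomorphism_onto_image[OF embedding_restrict[OF assms(1) that]] by simp
  note iso = this[OF assms(2)] this[OF assms(3)]
  show ?thesis
    using isomorphism_compose[OF isomorphism_inverse[OF iso(1)]
        isomorphism_compose[OF assms(4) iso(2)]]
    by (simp add: comp_assoc)
qed

section \<open>The automorphism group and its topology\<close>

lemma restrict_automorphism:
  assumes "isomorphism A A p"
  shows "restrict p (universe A) \<in> automorphisms A"
proof -
  have "isomorphism A A (restrict p (universe A))"
    using assms by (rule isomorphism_cong) simp
  moreover have "bij_betw p (universe A) (universe A)"
    using assms by (simp add: isomorphism_def embedding_def bij_betw_def)
  ultimately show ?thesis
    by (simp add: automorphisms_def Bij_def)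
qed

lemma automorphismD:
  assumes "g \<in> automorphisms A"
  shows "g \<in> Bij (universe A)" "isomorphism A A g"
  using assms by (auto simp: automorphisms_def)

lemma carrier_aut_group [simp]: "carrier (aut_group A) = automorphisms A"
  by (simp add: aut_group_def)

lemma subgroup_automorphisms: "subgroup (automorphisms A) (BijGroup (universe A))"
proof (rule group.subgroupI[OF group_BijGroup])
  show "automorphisms A \<subseteq> carrier (BijGroup (universe A))"
    by (auto simp: automorphisms_def BijGroup_def)
  have "isomorphism A A id"
    by (simp add: isomorphism_def embedding_def)
  then show "automorphisms A \<noteq> {}"
    using restrict_automorphism by blast
next
  fix g assume g: "g \<in> automorphisms A"
  then show "inv\<^bsub>BijGroup (universe A)\<^esub> g \<in> automorphisms A"
    using restrict_automorphism[OF isomorphism_inverse[OF automorphismD(2)[OF g]]]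
    by (simp add: inv_BijGroup automorphismD)
next
  fix g h assume g: "g \<in> automorphisms A" and h: "h \<in> automorphisms A"
  show "g \<otimes>\<^bsub>BijGroup (universe A)\<^esub> h \<in> automorphisms A"
    using g h restrict_automorphism[OF isomorphism_compose[OF automorphismD(2)[OF h] automorphismD(2)[OF g]]]
    by (simp add: BijGroup_def automorphismD compose_def comp_def)
qed

lemma group_aut_group: "group (aut_group A)"
  unfolding aut_group_def using group.subgroup_imp_group[OF group_BijGroup subgroup_automorphisms] .

lemma automorphism_closed: "g \<in> automorphisms A \<Longrightarrow> x \<in> universe A \<Longrightarrow> g x \<in> universe A"
  by (auto simp: automorphisms_def isomorphism_def)

lemma aut_group_mult_apply:
  assumes "g \<in> automorphisms A" "h \<in> automorphisms A" "x \<in> universe A"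
  shows "(g \<otimes>\<^bsub>aut_group A\<^esub> h) x = g (h x)"
  using assms by (simp add: aut_group_def BijGroup_def automorphismD compose_def)

lemma aut_group_one_apply: "x \<in> universe A \<Longrightarrow> \<one>\<^bsub>aut_group A\<^esub> x = x"
  by (simp add: aut_group_def BijGroup_def)

lemma aut_group_inv_apply:
  assumes "g \<in> automorphisms A" "x \<in> universe A"
  shows "(inv\<^bsub>aut_group A\<^esub> g) (g x) = x"
proof -
  interpret group "aut_group A" by (rule group_aut_group)
  have "(inv\<^bsub>aut_group A\<^esub> g \<otimes>\<^bsub>aut_group A\<^esub> g) x = x"
    using assms by (simp add: aut_group_one_apply)
  moreover have "inv\<^bsub>aut_group A\<^esub> g \<in> automorphisms A"
    using assms(1) inv_closed[of g] by simp
  ultimately show ?thesis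
    using assms aut_group_mult_apply by metis
qed

text \<open>A basic box around the identity constrains only finitely many coordinates. These form
  \<open>?A\<close>; at every other coordinate the constraint is satisfied because an automorphism
  maps the universe into itself. The topology of the group enters the proof only in this
  form.\<close>

lemma openin_aut_topology_one:
  assumes "openin (aut_topology F) N" "\<one>\<^bsub>aut_group F\<^esub> \<in> N"
  shows "\<exists>A. finite A \<and> A \<subseteq> universe F \<and>
    (\<forall>g\<in>automorphisms F. (\<forall>a\<in>A. g a = a) \<longrightarrow> g \<in> N)"
proof -
  let ?U = "universe F"
  obtain M where M: "openin (product_topology (\<lambda>_. discrete_topology ?U) ?U) M"
      "N = M \<inter> automorphisms F"
    using assms(1) by (auto simp: aut_topology_def openin_subtopology)
  then obtain B where B: "finite {i \<in> ?U. B i \<noteq> topspace (discrete_topology ?U)}"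
      "\<one>\<^bsub>aut_group F\<^esub> \<in> Pi\<^sub>E ?U B" "Pi\<^sub>E ?U B \<subseteq> M"
    using assms(2) by (auto simp: openin_product_topology_alt)
  let ?A = "{i \<in> ?U. B i \<noteq> ?U}"
  have "g \<in> N" if g: "g \<in> automorphisms F" "\<forall>a\<in>?A. g a = a" for g
  proof -
    have "g i \<in> B i" if i: "i \<in> ?U" for i
    proof (cases "i \<in> ?A")
      case True
      then have "g i = \<one>\<^bsub>aut_group F\<^esub> i"
        using g i by (auto simp: aut_group_one_apply)
      then show ?thesis
        using B(2) i by auto
    next
      case False
      then show ?thesis
        using automorphism_closed[OF g(1) i] i by simp
    qed
    moreover have "g \<in> extensional ?U"
      using automorphismD(1)[OF g(1)] by (simp add: Bij_def)
    ultimately have "g \<in> Pi\<^sub>E ?U B"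
      by (auto simp: PiE_def)
    then show ?thesis
      using B(3) M(2) g(1) by auto
  qed
  then show ?thesis
    using B(1) by (intro exI[of _ ?A]) auto
qed

section \<open>Ultrahomogeneity and embeddings of increasing unions\<close>

lemma ultrahomogeneous_embeddings:
  assumes "ultrahomogeneous F" "finite (universe A)" "embedding A F e" "embedding A F e'"
  shows "\<exists>g\<in>automorphisms F. \<forall>x\<in>universe A. g (e x) = e' x"
proof -
  let ?p = "e' \<circ> inv_into (universe A) e"
  have "isomorphism (induced F (e ` universe A)) (induced F (e' ` universe A)) ?p"
    using isomorphism_compose[OF isomorphism_inverse[OF isomorphism_onto_image[OF assms(3)]]
        isomorphism_onto_image[OF assms(4)]] .
  moreover have "e ` universe A \<subseteq> universe F" "e' ` universe A \<subseteq> universe F" "inj_on e (universe A)"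
    using assms(3,4) by (auto simp: embedding_def)
  ultimately obtain g where g: "g \<in> automorphisms F" "\<forall>x\<in>e ` universe A. g x = ?p x"
    using assms(1)[unfolded ultrahomogeneous_def, rule_format, of "e ` universe A" "e' ` universe A" ?p]
      assms(2) by blast
  then show ?thesis
    using \<open>inj_on e (universe A)\<close> by (intro bexI[of _ g]) auto
qed

text \<open>An arbitrary embedding of stage \<open>n + 1\<close> can be corrected by an automorphism
  of \<open>F\<close> so that it extends the embedding already chosen on stage \<open>n\<close>.
  Dependent choice turns this into a coherent chain, whose union is the required embedding.\<close>

lemma embedding_increasing_union:
  fixes A :: "('b, 'r) relstruct"
  assumes "ultrahomogeneous F"
    and S: "\<And>n. finite (S n)" "\<And>n. S n \<subseteq> S (Suc n)" "(\<Union>n. S n) = universe A"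
    and emb: "\<And>n. \<exists>e. embedding (induced A (S n)) F e"
  shows "\<exists>e. embedding A F e"
proof -
  have "\<exists>e. \<forall>n. embedding (induced A (S n)) F (e n) \<and> (\<forall>x\<in>S n. e (Suc n) x = e n x)"
  proof (rule dependent_nat_choice[where P = "\<lambda>n. embedding (induced A (S n)) F"
        and Q = "\<lambda>n d e. \<forall>x\<in>S n. e x = d x"])
    fix d n assume d: "embedding (induced A (S n)) F d"
    obtain c where c: "embedding (induced A (S (Suc n))) F c"
      using emb by blast
    then have c': "embedding (induced A (S n)) F c"
      using embedding_restrict[OF c, of "S n"] S(2) by (simp add: induced_induced)
    then obtain g where g: "g \<in> automorphisms F" "\<forall>x\<in>S n. g (c x) = d x"
      using ultrahomogeneous_embeddings[OF assms(1) _ c' d] S(1) by auto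
    have "embedding (induced A (S (Suc n))) F (g \<circ> c)"
      using embedding_compose[OF c, of F g] automorphismD(2)[OF g(1)] by (simp add: isomorphism_def)
    then show "\<exists>e. embedding (induced A (S (Suc n))) F e \<and> (\<forall>x\<in>S n. e x = d x)"
      using g(2) by (intro exI[of _ "g \<circ> c"]) auto
  qed (use emb in blast)
  then obtain e where e: "\<And>n. embedding (induced A (S n)) F (e n)"
      "\<And>n x. x \<in> S n \<Longrightarrow> e (Suc n) x = e n x"
    by blast
  have S_mono: "S m \<subseteq> S n" if "m \<le> n" for m n
    using that S(2) by (rule lift_Suc_mono_le[rotated])
  have stable: "e n x = e m x" if "m \<le> n" "x \<in> S m" for m n x
    using that
  proof (induction n rule: dec_induct)
    case (step n)
    then show ?case
      using e(2)[of x n] S_mono[of m n] by auto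
  qed simp
  \<comment> \<open>By \<open>stable\<close>, every stage containing \<open>x\<close> gives the same
    value; the least one merely fixes a choice.\<close>
  define d where "d x = e (LEAST n. x \<in> S n) x" for x
  have d: "d x = e n x" if "x \<in> S n" for n x
    unfolding d_def
    using stable[of "LEAST n. x \<in> S n" n x] Least_le[of "\<lambda>n. x \<in> S n"] LeastI[of "\<lambda>n. x \<in> S n"] that
    by simp
  have emb_d: "embedding (induced A (S n)) F d" for n
    using e(1) by (rule embedding_cong) (simp add: d)
  \<comment> \<open>Injectivity and preservation of relations each concern finitely many points at a
    time, so they can be checked inside a single \<open>S n\<close>.\<close>
  have stage: "\<exists>n. set xs \<subseteq> S n" if "set xs \<subseteq> universe A" for xs :: "'b list"
    using that
  proof (induction xs)
    case (Cons x xs)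
    have "x \<in> (\<Union>n. S n)" "\<exists>n. set xs \<subseteq> S n"
      using Cons S(3) by auto
    then obtain n m where "set xs \<subseteq> S n" "x \<in> S m"
      by blast
    then show ?case
      using S_mono[of n "max n m"] S_mono[of m "max n m"] by (intro exI[of _ "max n m"]) auto
  qed simp
  have "inj_on d (universe A)"
  proof (rule inj_onI)
    fix x y assume xy: "x \<in> universe A" "y \<in> universe A" "d x = d y"
    then have "\<exists>n. set [x, y] \<subseteq> S n"
      by (intro stage) simp
    then obtain n where "x \<in> S n" "y \<in> S n"
      by auto
    then show "x = y"
      using emb_d[of n] xy(3) by (auto simp: embedding_def inj_on_def)
  qed
  moreover have "d x \<in> universe F" if "x \<in> universe A" for x
  proof -
    have "x \<in> (\<Union>n. S n)"
      using S(3) that by simp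
    then show ?thesis
      using emb_d by (auto simp: embedding_def)
  qed
  moreover have "xs \<in> interp A R \<longleftrightarrow> map d xs \<in> interp F R" if xs: "set xs \<subseteq> universe A" for xs R
  proof -
    obtain n where "set xs \<subseteq> S n"
      using stage[OF xs] by blast
    then show ?thesis
      using emb_d[of n] by (simp add: embedding_def induced_def lists_eq_set)
  qed
  ultimately have "embedding A F d"
    by (auto simp: embedding_def)
  then show ?thesis
    by blast
qed

section \<open>The free sum of infinitely many copies of a structure\<close>

text \<open>The free sum of countably many copies of \<open>B\<close>: the codes with first
  component \<open>n\<close> form block \<open>n\<close>. Pairs are encoded so that the universe
  stays a set of natural numbers, as the Henson property is stated for such structures.\<close>

definition copies :: "(nat, 'r) relstruct \<Rightarrow> (nat, 'r) relstruct" where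
  "copies B = \<lparr>universe = {w. snd (prod_decode w) \<in> universe B},
     interp = (\<lambda>R. \<Union>n. map (\<lambda>b. prod_encode (n, b)) ` interp B R)\<rparr>"

lemma map_block_decode: "map (\<lambda>w. snd (prod_decode w)) (map (\<lambda>b. prod_encode (n, b)) ys) = ys"
  by (induction ys) auto

lemma interp_copies:
  "xs \<in> interp (copies B) R \<longleftrightarrow> (\<exists>n. \<exists>ys\<in>interp B R. xs = map (\<lambda>b. prod_encode (n, b)) ys)"
  by (auto simp: copies_def)

lemma is_relstruct_copies: "is_relstruct ar B \<Longrightarrow> is_relstruct ar (copies B)"
  by (fastforce simp: is_relstruct_def copies_def)

lemma embedding_block: "embedding B (copies B) (\<lambda>b. prod_encode (n, b))"
  unfolding embedding_def
proof (intro conjI allI ballI)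
  fix R xs
  show "xs \<in> interp B R \<longleftrightarrow> map (\<lambda>b. prod_encode (n, b)) xs \<in> interp (copies B) R"
  proof
    assume "map (\<lambda>b. prod_encode (n, b)) xs \<in> interp (copies B) R"
    then obtain m ys where "map (\<lambda>b. prod_encode (n, b)) xs = map (\<lambda>b. prod_encode (m, b)) ys"
      "ys \<in> interp B R"
      by (auto simp: copies_def)
    then show "xs \<in> interp B R"
      by (metis map_block_decode)
  qed (auto simp: copies_def)
qed (auto simp: inj_on_def copies_def)

text \<open>No tuple in a relation of \<open>copies B\<close> meets two blocks, so automorphisms of
  \<open>B\<close> can be chosen independently on the blocks. This independence is what later
  realises an arbitrary 0-1 pattern.\<close>

lemma isomorphism_blockwise:
  assumes "is_relstruct ar B" "\<And>n. isomorphism B B (k n)"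
  shows "isomorphism (copies B) (copies B)
    (\<lambda>w. prod_encode (fst (prod_decode w), k (fst (prod_decode w)) (snd (prod_decode w))))"
    (is "isomorphism _ _ ?f")
proof -
  have inj: "inj_on (k n) (universe B)" and img: "k n ` universe B = universe B"
    and rel: "set ys \<subseteq> universe B \<Longrightarrow> ys \<in> interp B R \<longleftrightarrow> map (k n) ys \<in> interp B R" for n R ys
    using assms(2)[of n] unfolding isomorphism_def embedding_def lists_eq_set by blast+
  have univ: "universe (copies B) = {prod_encode (n, b) | n b. b \<in> universe B}"
    by (auto simp: copies_def) (metis prod.collapse prod_decode_inverse)
  have "inj_on ?f (universe (copies B))"
    using inj by (auto simp: inj_on_def univ)
  moreover have "?f ` universe (copies B) = universe (copies B)"
  proof -
    have "prod_encode (n, b) \<in> ?f ` universe (copies B)" if b: "b \<in> universe B" for n b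
    proof -
      obtain c where c: "c \<in> universe B" "b = k n c"
        using b img[of n] by (metis imageE)
      show ?thesis
      proof (rule image_eqI)
        show "prod_encode (n, b) = ?f (prod_encode (n, c))"
          using c(2) by simp
      qed (use c(1) in \<open>simp add: copies_def\<close>)
    qed
    moreover have "?f w \<in> universe (copies B)" if "w \<in> universe (copies B)" for w
      using that img by (auto simp: copies_def)
    ultimately show ?thesis
      unfolding univ by blast
  qed
  moreover have "xs \<in> interp (copies B) R \<longleftrightarrow> map ?f xs \<in> interp (copies B) R"
    if xs: "xs \<in> lists (universe (copies B))" for xs R
  proof
    assume "xs \<in> interp (copies B) R"
    then obtain n ys where ys: "xs = map (\<lambda>b. prod_encode (n, b)) ys" "ys \<in> interp B R"
      unfolding interp_copies by blast
    then have "set ys \<subseteq> universe B"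
      using assms(1) by (auto simp: is_relstruct_def)
    then have "map (k n) ys \<in> interp B R"
      using rel ys(2) by blast
    moreover have "map ?f xs = map (\<lambda>b. prod_encode (n, b)) (map (k n) ys)"
      using ys(1) by simp
    ultimately show "map ?f xs \<in> interp (copies B) R"
      unfolding interp_copies by blast
  next
    assume "map ?f xs \<in> interp (copies B) R"
    then obtain n ys where ys: "map ?f xs = map (\<lambda>b. prod_encode (n, b)) ys" "ys \<in> interp B R"
      unfolding interp_copies by blast
    let ?zs = "map (\<lambda>w. snd (prod_decode w)) xs"
    \<comment> \<open>The map preserves block indices, so a tuple whose image lies in block
      \<open>n\<close> lies in block \<open>n\<close> itself.\<close>
    have fst: "fst (prod_decode w) = n" if "w \<in> set xs" for w
    proof -
      have "?f w \<in> set (map (\<lambda>b. prod_encode (n, b)) ys)"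
        using that unfolding ys(1)[symmetric] by simp
      then show ?thesis
        by auto
    qed
    have "map (k n) ?zs = map (\<lambda>w. snd (prod_decode w)) (map ?f xs)"
      using fst by simp
    then have "map (k n) ?zs = ys"
      using ys(1) map_block_decode by metis
    moreover have "set ?zs \<subseteq> universe B"
      using xs by (auto simp: copies_def)
    ultimately have "?zs \<in> interp B R"
      using rel ys(2) by metis
    moreover have "xs = map (\<lambda>b. prod_encode (n, b)) ?zs"
    proof -
      have "prod_encode (n, snd (prod_decode w)) = w" if "w \<in> set xs" for w
        using fst[OF that] by (metis prod.collapse prod_decode_inverse)
      then show ?thesis
        by (simp add: map_idI)
    qed
    ultimately show "xs \<in> interp (copies B) R"
      unfolding interp_copies by blast
  qed
  ultimately show ?thesis
    by (simp add: isomorphism_def embedding_def)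
qed

text \<open>The blocks up to \<open>n + 1\<close> split freely into the blocks up to
  \<open>n\<close> and one more copy of \<open>B\<close>. This is the inductive step for placing
  finite sums of copies in the age by free joint embedding.\<close>

lemma embedding_copies_step:
  fixes B :: "(nat, 'r) relstruct"
  assumes "is_relstruct ar B"
  defines "S \<equiv> \<lambda>n. {w \<in> universe (copies B). fst (prod_decode w) \<le> n}"
  shows "embedding (induced (copies B) (S (Suc n))) (disjoint_sum (induced (copies B) (S n)) B)
    (\<lambda>w. if fst (prod_decode w) \<le> n then Inl w else Inr (snd (prod_decode w)))"
    (is "embedding ?A ?D ?e")
proof -
  have "inj_on ?e (S (Suc n))"
  proof (rule inj_onI)
    fix v w assume "v \<in> S (Suc n)" "w \<in> S (Suc n)" "?e v = ?e w"
    then have "prod_decode v = prod_decode w"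
      by (auto simp: S_def prod_eq_iff split: if_splits)
    then show "v = w"
      by (metis prod_decode_inverse)
  qed
  moreover have "?e ` S (Suc n) \<subseteq> universe ?D"
    by (auto simp: S_def disjoint_sum_def copies_def)
  moreover have "xs \<in> interp ?A R \<longleftrightarrow> map ?e xs \<in> interp ?D R"
    if xs: "set xs \<subseteq> S (Suc n)" for xs R
  proof
    assume "xs \<in> interp ?A R"
    then obtain m ys where ys: "xs = map (\<lambda>b. prod_encode (m, b)) ys" "ys \<in> interp B R"
      and xsW: "xs \<in> interp (copies B) R"
      by (auto simp: copies_def induced_def)
    show "map ?e xs \<in> interp ?D R"
    proof (cases "m \<le> n")
      case True
      then have eq: "map ?e xs = map Inl xs" and "set xs \<subseteq> S n"
        using ys(1) xs by (auto simp: S_def)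
      then show ?thesis
        unfolding eq using xsW by (simp add: disjoint_sum_def induced_def)
    next
      case False
      then have "map ?e xs = map Inr ys"
        using ys(1) by simp
      then show ?thesis
        using ys(2) by (auto simp: disjoint_sum_def)
    qed
  next
    assume "map ?e xs \<in> interp ?D R"
    then consider zs where "map ?e xs = map Inl zs" "zs \<in> interp (copies B) R"
      | ys where "map ?e xs = map Inr ys" "ys \<in> interp B R"
      by (auto simp: disjoint_sum_def induced_def)
    then have "xs \<in> interp (copies B) R"
    proof cases
      case 1
      from 1(1) have "xs = zs"
        by (induction xs arbitrary: zs) (auto split: if_splits)
      then show ?thesis
        using 1(2) by simp
    next
      case 2
      \<comment> \<open>Entries sent to the right summand have block index above \<open>n\<close>,
        and within \<open>S (Suc n)\<close> that index can only be \<open>Suc n\<close>.\<close>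
      from 2(1) xs have "xs = map (\<lambda>b. prod_encode (Suc n, b)) ys"
      proof (induction xs arbitrary: ys)
        case (Cons w xs)
        then obtain b ys' where ys: "ys = b # ys'" "map ?e xs = map Inr ys'"
            "?e w = Inr b"
          by auto
        then have "fst (prod_decode w) = Suc n" "snd (prod_decode w) = b"
          using Cons.prems(2) by (auto simp: S_def split: if_splits)
        then have "w = prod_encode (Suc n, b)"
          by (metis prod.collapse prod_decode_inverse)
        then show ?case
          using Cons ys by simp
      qed simp
      then show ?thesis
        using 2(2) unfolding interp_copies by blast
    qed
    then show "xs \<in> interp ?A R"
      using xs by (simp add: induced_def)
  qed
  ultimately show ?thesis
    by (auto simp: embedding_def)
qed

text \<open>Induction with free joint embedding puts every finite initial sum into the age, starting
  from block 0, which is a copy of \<open>B\<close>. Ultrahomogeneity then passes to the union of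
  these finite stages.\<close>

lemma embedding_copies:
  fixes B :: "(nat, 'r) relstruct"
  assumes "ultrahomogeneous F" "free_joint_embedding ar F" "in_age ar F B"
  shows "\<exists>e. embedding (copies B) F e"
proof -
  let ?S = "\<lambda>n. {w \<in> universe (copies B). fst (prod_decode w) \<le> n}"
  have B: "is_relstruct ar B" "finite (universe B)"
    using assms(3) by (auto simp: in_age_def)
  have fin: "finite (?S n)" for n
  proof (rule finite_subset)
    show "?S n \<subseteq> prod_encode ` ({..n} \<times> universe B)"
    proof
      fix w assume "w \<in> ?S n"
      then show "w \<in> prod_encode ` ({..n} \<times> universe B)"
        by (intro image_eqI[of _ _ "prod_decode w"]) (auto simp: copies_def mem_Times_iff)
    qed
  qed (use B in simp)
  have rs: "is_relstruct ar (induced (copies B) (?S n))" for n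
    using is_relstruct_induced[OF is_relstruct_copies[OF B(1)]] .
  have emb: "\<exists>e. embedding (induced (copies B) (?S n)) F e" for n
  proof (induction n)
    case 0
    have S0: "?S 0 = (\<lambda>b. prod_encode (0, b)) ` universe B"
    proof (intro equalityI subsetI)
      fix w assume "w \<in> ?S 0"
      then show "w \<in> (\<lambda>b. prod_encode (0, b)) ` universe B"
        by (intro image_eqI[of _ _ "snd (prod_decode w)"])
          (auto simp: copies_def, metis prod.collapse prod_decode_inverse)
    qed (auto simp: copies_def)
    have "isomorphism (induced (copies B) (?S 0)) B
        (inv_into (universe B) (\<lambda>b. prod_encode (0, b)))"
      unfolding S0 by (rule isomorphism_inverse[OF isomorphism_onto_image[OF embedding_block]])
    then show ?case
      using assms(3) embedding_compose unfolding isomorphism_def in_age_def by blast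
  next
    case (Suc n)
    then have "in_age ar F (induced (copies B) (?S n))"
      using rs fin by (simp add: in_age_def)
    then have "in_age ar F (disjoint_sum (induced (copies B) (?S n)) B)"
      using assms(2,3) by (simp add: free_joint_embedding_def)
    then show ?case
      using embedding_compose[OF embedding_copies_step[OF B(1)]] unfolding in_age_def by blast
  qed
  have "(\<Union>n. ?S n) = universe (copies B)"
    by blast
  moreover have "?S n \<subseteq> ?S (Suc n)" for n
    by auto
  ultimately show ?thesis
    using embedding_increasing_union[OF assms(1), of ?S "copies B"] fin emb by blast
qed

section \<open>Using the Henson and Hrushovski properties inside \<open>F\<close>\<close>

text \<open>Conjugating \<open>p\<close> by \<open>h\<close> gives an automorphism of the image of
  \<open>A\<close>, which the Henson property extends. The result is phrased on \<open>A\<close>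
  itself so that it applies directly to blockwise maps of \<open>copies B\<close>.\<close>

lemma henson_extension:
  fixes A :: "(nat, 'r) relstruct"
  assumes "henson_property ar F" "is_relstruct ar A" "\<exists>e. embedding A F e"
  shows "\<exists>h. embedding A F h \<and>
    (\<forall>p. isomorphism A A p \<longrightarrow> (\<exists>g\<in>automorphisms F. \<forall>x\<in>universe A. g (h x) = h (p x)))"
proof -
  have "\<exists>h. embedding A F h \<and> (\<forall>g\<in>automorphisms (induced F (h ` universe A)).
      \<exists>g'\<in>automorphisms F. \<forall>x\<in>h ` universe A. g' x = g x)"
    using assms by (simp add: henson_property_def)
  then obtain h where h: "embedding A F h"
    and ext: "\<And>g. g \<in> automorphisms (induced F (h ` universe A)) \<Longrightarrow>
      \<exists>g'\<in>automorphisms F. \<forall>x\<in>h ` universe A. g' x = g x"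
    by blast
  have inj: "inj_on h (universe A)"
    using h by (simp add: embedding_def)
  note iso = isomorphism_onto_image[OF h]
  have "\<exists>g\<in>automorphisms F. \<forall>x\<in>universe A. g (h x) = h (p x)" if p: "isomorphism A A p" for p
  proof -
    let ?q = "(h \<circ> p) \<circ> inv_into (universe A) h"
    have "isomorphism (induced F (h ` universe A)) (induced F (h ` universe A)) ?q"
      using isomorphism_compose[OF isomorphism_inverse[OF iso] isomorphism_compose[OF p iso]] .
    from ext[OF restrict_automorphism[OF this]] show ?thesis
      using inj by auto
  qed
  then show ?thesis
    using h by blast
qed

text \<open>The Hrushovski property is stated for structures on natural numbers, so the substructure
  on \<open>C\<close> is first relabelled as \<open>D\<close> along an injection \<open>c\<close>.
  Partial isomorphisms inside \<open>C\<close> are then conjugated by \<open>m\<close> into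
  \<open>B\<close> and extended there.\<close>

lemma hrushovski_extension:
  assumes "is_relstruct ar F" "hrushovski_property ar F" "finite C" "C \<subseteq> universe F"
  shows "\<exists>(B :: (nat, 'r) relstruct) m. in_age ar F B \<and> embedding (induced F C) B m \<and>
    (\<forall>S T p. S \<subseteq> C \<and> T \<subseteq> C \<and> isomorphism (induced F S) (induced F T) p \<longrightarrow>
       (\<exists>k\<in>automorphisms B. \<forall>x\<in>S. k (m x) = m (p x)))"
proof -
  obtain c :: "'a \<Rightarrow> nat" where c: "inj_on c C"
    using finite_imp_inj_to_nat_seg[OF assms(3)] by blast
  define D where "D = \<lparr>universe = c ` C, interp = (\<lambda>R. map c ` interp (induced F C) R)\<rparr>"
  have cD: "isomorphism (induced F C) D c"
    unfolding isomorphism_def embedding_def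
  proof (intro conjI allI ballI)
    fix R xs assume xs: "xs \<in> lists (universe (induced F C))"
    show "xs \<in> interp (induced F C) R \<longleftrightarrow> map c xs \<in> interp D R"
    proof
      assume "map c xs \<in> interp D R"
      then obtain ys where ys: "ys \<in> interp (induced F C) R" "map c xs = map c ys"
        by (auto simp: D_def)
      have "set xs \<union> set ys \<subseteq> C"
        using xs ys(1) by (auto simp: induced_def)
      then have "xs = ys"
        using c by (intro map_inj_on[OF ys(2)]) (rule inj_on_subset)
      then show "xs \<in> interp (induced F C) R"
        using ys by simp
    qed (simp add: D_def)
  qed (use c in \<open>auto simp: D_def\<close>)
  have "is_relstruct ar D"
    using is_relstruct_induced[OF assms(1), of C] by (fastforce simp: D_def is_relstruct_def)
  moreover have "embedding D (induced F C) (inv_into C c)"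
    using isomorphism_inverse[OF cD] by (simp add: isomorphism_def)
  note embedding_compose[OF this embedding_induced[OF assms(4)]]
  ultimately have "in_age ar F D"
    using assms(3) by (auto simp: in_age_def D_def)
  then have "\<exists>(B :: (nat, 'r) relstruct) h. in_age ar F B \<and> embedding D B h \<and>
      (\<forall>S T p. S \<subseteq> h ` universe D \<and> T \<subseteq> h ` universe D \<and>
         isomorphism (induced B S) (induced B T) p \<longrightarrow>
         (\<exists>g\<in>automorphisms B. \<forall>x\<in>S. g x = p x))"
    using assms(2) by (simp only: hrushovski_property_def)
  then obtain B :: "(nat, 'r) relstruct" and h where B: "in_age ar F B" "embedding D B h"
    and ext: "\<forall>S T p. S \<subseteq> h ` universe D \<and> T \<subseteq> h ` universe D \<and>
      isomorphism (induced B S) (induced B T) p \<longrightarrow> (\<exists>g\<in>automorphisms B. \<forall>x\<in>S. g x = p x)"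
    by (elim exE conjE) (rule that)
  let ?m = "h \<circ> c"
  have m: "embedding (induced F C) B ?m"
    using embedding_compose[OF _ B(2), of "induced F C" c] cD by (simp add: isomorphism_def)
  then have inj: "inj_on ?m C"
    by (simp add: embedding_def)
  have lift: "\<exists>k\<in>automorphisms B. \<forall>x\<in>S. k (?m x) = ?m (p x)"
    if ST: "S \<subseteq> C" "T \<subseteq> C" and p: "isomorphism (induced F S) (induced F T) p" for S T p
  proof -
    have "isomorphism (induced B (?m ` S)) (induced B (?m ` T)) (?m \<circ> p \<circ> inv_into S ?m)"
      using ST p by (intro isomorphism_embedding_image[OF m]) (simp_all add: induced_induced)
    moreover have "?m ` S \<subseteq> h ` universe D" "?m ` T \<subseteq> h ` universe D"
      using ST by (auto simp: D_def)
    ultimately obtain k where "k \<in> automorphisms B"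
        "\<forall>x\<in>?m ` S. k x = (?m \<circ> p \<circ> inv_into S ?m) x"
      using ext[rule_format, of "?m ` S" "?m ` T"] by blast
    moreover have "inv_into S ?m (?m x) = x" if "x \<in> S" for x
      using inj_on_subset[OF inj ST(1)] that by (rule inv_into_f_f)
    ultimately show ?thesis
      by (intro bexI[of _ k]) auto
  qed
  have "\<forall>S T p. S \<subseteq> C \<and> T \<subseteq> C \<and> isomorphism (induced F S) (induced F T) p \<longrightarrow>
      (\<exists>k\<in>automorphisms B. \<forall>x\<in>S. k (?m x) = ?m (p x))"
    by (intro allI impI, elim conjE) (rule lift)
  then show ?thesis
    using B(1) m by (intro exI conjI)
qed

text \<open>The copies \<open>u n ` C\<close> lie in distinct summands of an infinite free sum of finite structures,
  so \<open>g\<close> can be switched on and off in each copy separately: the sum is placed in \<open>F\<close> by the Henson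
  property, and \<open>g\<close> acts on a summand by the Hrushovski property.\<close>

lemma independent_copies:
  fixes F :: "('a, 'r) relstruct"
  assumes "fraisse_structure ar F" "henson_property ar F" "hrushovski_property ar F"
    "free_joint_embedding ar F" "finite C" "C \<subseteq> universe F" "C \<noteq> {}"
  shows "\<exists>u :: nat \<Rightarrow> 'a \<Rightarrow> 'a. inj u \<and> range u \<subseteq> automorphisms F \<and>
    (\<forall>g A s. g \<in> automorphisms F \<and> A \<subseteq> C \<and> g ` A \<subseteq> C \<longrightarrow>
      (\<exists>k\<in>automorphisms F. \<forall>n. \<forall>a\<in>A. k (u n a) = u n (if s n then g a else a)))"
proof -
  have F: "is_relstruct ar F" "ultrahomogeneous F"
    using assms(1) by (auto simp: fraisse_structure_def)
  obtain B :: "(nat, 'r) relstruct" and m where B: "in_age ar F B" "embedding (induced F C) B m"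
    and extB: "\<forall>S T p. S \<subseteq> C \<and> T \<subseteq> C \<and> isomorphism (induced F S) (induced F T) p \<longrightarrow>
       (\<exists>k\<in>automorphisms B. \<forall>x\<in>S. k (m x) = m (p x))"
    using hrushovski_extension[OF F(1) assms(3,5,6)] by (elim exE conjE) (rule that)
  have relB: "is_relstruct ar B"
    using B(1) by (simp add: in_age_def)
  obtain H where H: "embedding (copies B) F H"
    and extH: "\<forall>p. isomorphism (copies B) (copies B) p \<longrightarrow>
      (\<exists>g\<in>automorphisms F. \<forall>w\<in>universe (copies B). g (H w) = H (p w))"
    using henson_extension[OF assms(2) is_relstruct_copies[OF relB]
        embedding_copies[OF F(2) assms(4) B(1)]] by (elim exE conjE) (rule that)
  \<comment> \<open>Both the inclusion of \<open>C\<close> and its placement in block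
    \<open>n\<close>, followed by \<open>H\<close>, embed the same finite substructure into
    \<open>F\<close>; the automorphism \<open>u n\<close> carries the first to the second.\<close>
  have "\<exists>g\<in>automorphisms F. \<forall>x\<in>C. g x = H (prod_encode (n, m x))" for n
    using ultrahomogeneous_embeddings[OF F(2) _ embedding_induced[OF assms(6)]
        embedding_compose[OF embedding_compose[OF B(2) embedding_block] H]] assms(5) by simp
  then obtain u where u: "\<And>n. u n \<in> automorphisms F"
      "\<And>n x. x \<in> C \<Longrightarrow> u n x = H (prod_encode (n, m x))"
    by metis
  have mB: "m x \<in> universe B" if "x \<in> C" for x
    using B(2) that by (auto simp: embedding_def)
  have W: "prod_encode (n, m x) \<in> universe (copies B)" if "x \<in> C" for n x
    using mB[OF that] by (simp add: copies_def)
  \<comment> \<open>A point of \<open>C\<close> is sent into different blocks by \<open>u n\<close>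
    for different \<open>n\<close>; this is where \<open>C\<close> must be nonempty.\<close>
  have "inj u"
  proof (rule injI)
    fix n l assume eq: "u n = u l"
    obtain x where x: "x \<in> C"
      using assms(7) by blast
    then have "H (prod_encode (n, m x)) = H (prod_encode (l, m x))"
      using u(2) eq by metis
    then have "prod_encode (n, m x) = prod_encode (l, m x)"
      using H W[OF x] unfolding embedding_def by (meson inj_onD)
    then show "n = l"
      by simp
  qed
  moreover have "\<exists>k\<in>automorphisms F. \<forall>n. \<forall>a\<in>A. k (u n a) = u n (if s n then g a else a)"
    if g: "g \<in> automorphisms F" and A: "A \<subseteq> C" "g ` A \<subseteq> C" for g A s
  proof -
    have "embedding F F g" "A \<subseteq> universe F"
      using automorphismD(2)[OF g] A(1) assms(6) by (auto simp: isomorphism_def)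
    then have "isomorphism (induced F A) (induced F (g ` A)) g"
      using isomorphism_onto_image[OF embedding_restrict[of F F g A]] by simp
    then obtain k where k: "k \<in> automorphisms B" "\<forall>x\<in>A. k (m x) = m (g x)"
      using extB[rule_format, of A "g ` A" g] A by blast
    define p where "p n = (if s n then k else id)" for n :: nat
    have "isomorphism B B id"
      by (simp add: isomorphism_def embedding_def)
    then have "isomorphism B B (p n)" for n
      using automorphismD(2)[OF k(1)] by (simp add: p_def)
    from extH[rule_format, OF isomorphism_blockwise[OF relB, of p, OF this]]
    obtain k' where k': "k' \<in> automorphisms F" "\<forall>w\<in>universe (copies B). k' (H w) =
        H (prod_encode (fst (prod_decode w), p (fst (prod_decode w)) (snd (prod_decode w))))"
      by blast
    have "k' (u n a) = u n (if s n then g a else a)" if "a \<in> A" for n a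
    proof -
      have "k' (u n a) = H (prod_encode (n, p n (m a)))"
        using k'(2) W[of a n] u(2) that A(1) by auto
      also have "\<dots> = u n (if s n then g a else a)"
        using that A k(2) u(2) by (auto simp: p_def)
      finally show ?thesis .
    qed
    then show ?thesis
      using k'(1) by blast
  qed
  ultimately show ?thesis
    using u(1) by (intro exI[of _ u]) auto
qed

section \<open>IT-pairs and continuity of the action\<close>

text \<open>Tameness excludes only IT-pairs separated by a continuous real function. A compact
  Hausdorff space is normal, so by Urysohn's lemma any two distinct points are separated in this
  way.\<close>

lemma tame_flow_IT_pair:
  assumes "tame_flow G T X \<phi>" "IT_pair G X \<phi> x y"
  shows "x = y"
proof (rule ccontr)
  assume "x \<noteq> y"
  have "compact_space X" "Hausdorff_space X"
    using assms(1) by (auto simp: tame_flow_def flow_def)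
  moreover have xy: "x \<in> topspace X" "y \<in> topspace X"
    using assms(2) by (auto simp: IT_pair_def)
  ultimately have "normal_space X" "closedin X {x}" "closedin X {y}"
    by (auto simp: compact_Hausdorff_or_regular_imp_normal_space closedin_Hausdorff_singleton)
  then obtain f :: "_ \<Rightarrow> real" where "continuous_map X euclideanreal f" "f ` {x} \<subseteq> {0}" "f ` {y} \<subseteq> {1}"
    using Urysohn_lemma_alt[of X "{x}" "{y}" 0 1] \<open>x \<noteq> y\<close> by (auto simp: disjnt_def)
  then show False
    using assms \<open>x \<noteq> y\<close> unfolding tame_flow_def by fastforce
qed

text \<open>Joint continuity at the identity and \<open>\<phi> g y\<close> gives a product
  neighbourhood \<open>N \<times> W\<close> mapped into \<open>V\<close>. Then \<open>A\<close>
  comes from a stabiliser inside \<open>N\<close>, and \<open>O'\<close> is the preimage of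
  \<open>W\<close> under \<open>\<phi> g\<close>.\<close>

lemma flow_nearly_fixed:
  assumes "flow (aut_group F) (aut_topology F) X \<phi>" "g \<in> automorphisms F"
    "y \<in> topspace X" "openin X V" "\<phi> g y \<in> V"
  shows "\<exists>A O'. finite A \<and> A \<subseteq> universe F \<and> openin X O' \<and> y \<in> O' \<and>
    (\<forall>v\<in>automorphisms F. \<forall>z\<in>O'. (\<forall>a\<in>A. v a = a) \<longrightarrow> \<phi> v (\<phi> g z) \<in> V)"
proof -
  interpret group_action "aut_group F" "topspace X" \<phi>
    using assms(1) by (simp add: flow_def)
  have cont: "continuous_map (prod_topology (aut_topology F) X) X (\<lambda>(g, x). \<phi> g x)"
    using assms(1) by (simp add: flow_def)
  have top: "topspace (aut_topology F) = automorphisms F"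
    by (auto simp: aut_topology_def automorphisms_def Bij_def PiE_def bij_betw_def)
  have "\<phi> g y \<in> topspace X"
    using assms(4,5) openin_subset by blast
  let ?P = "{q \<in> topspace (prod_topology (aut_topology F) X). (\<lambda>(g, x). \<phi> g x) q \<in> V}"
  have "openin (prod_topology (aut_topology F) X) ?P"
    using openin_continuous_map_preimage[OF cont assms(4)] .
  moreover have "\<one>\<^bsub>aut_group F\<^esub> \<in> automorphisms F"
    using group.is_monoid[OF group_aut_group] monoid.one_closed by fastforce
  then have "(\<one>\<^bsub>aut_group F\<^esub>, \<phi> g y) \<in> ?P"
    using assms(5) \<open>\<phi> g y \<in> topspace X\<close> fun_cong[OF id_eq_one, of "\<phi> g y"]
    by (auto simp: top)
  ultimately obtain N W where NW: "openin (aut_topology F) N" "openin X W"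
      "\<one>\<^bsub>aut_group F\<^esub> \<in> N" "\<phi> g y \<in> W" "N \<times> W \<subseteq> ?P"
    unfolding openin_prod_topology_alt by meson
  obtain A where A: "finite A" "A \<subseteq> universe F"
      "\<forall>v\<in>automorphisms F. (\<forall>a\<in>A. v a = a) \<longrightarrow> v \<in> N"
    using openin_aut_topology_one[OF NW(1,3)] by blast
  have "continuous_map X (prod_topology (aut_topology F) X) (\<lambda>z. (g, z))"
    using assms(2) top by (simp add: continuous_map_pairwise comp_def)
  from continuous_map_compose[OF this cont]
  have "continuous_map X X (\<phi> g)"
    by (simp add: comp_def)
  then have "openin X {z \<in> topspace X. \<phi> g z \<in> W}"
    using openin_continuous_map_preimage NW(2) by blast
  moreover have "\<phi> v w \<in> V" if "v \<in> N" "w \<in> W" for v w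
    using NW(5) that by auto
  ultimately show ?thesis
    using A NW(4) assms(3) by (intro exI[of _ A] exI[of _ "{z \<in> topspace X. \<phi> g z \<in> W}"]) auto
qed

section \<open>Fixed points of tame flows\<close>

theorem tame_flow_fixed_point:
  fixes F :: "('a, 'r) relstruct" and X :: "'x topology"
  assumes "fraisse_structure ar F" "henson_property ar F" "hrushovski_property ar F"
    "free_joint_embedding ar F" and tame: "tame_flow (aut_group F) (aut_topology F) X \<phi>"
  shows "\<exists>x\<in>topspace X. \<forall>g\<in>automorphisms F. \<phi> g x = x"
proof (rule ccontr)
  let ?G = "aut_group F"
  assume "\<not> ?thesis"
  then have moved: "\<exists>g\<in>automorphisms F. \<phi> g y \<noteq> y" if "y \<in> topspace X" for y
    using that by blast
  have fl: "flow ?G (aut_topology F) X \<phi>"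
    using tame by (simp add: tame_flow_def)
  then have X: "topspace X \<noteq> {}" "compact_space X"
    by (auto simp: flow_def)
  interpret group_action ?G "topspace X" \<phi>
    using fl by (simp add: flow_def)
  interpret group ?G
    by (rule group_aut_group)
  have inv: "inv\<^bsub>?G\<^esub> g \<in> automorphisms F" if "g \<in> automorphisms F" for g
    using inv_closed[of g] that by simp
  have mult: "g \<otimes>\<^bsub>?G\<^esub> h \<in> automorphisms F" if "g \<in> automorphisms F" "h \<in> automorphisms F" for g h
    using m_closed[of g h] that by simp
  have one: "\<one>\<^bsub>?G\<^esub> \<in> automorphisms F"
    using one_closed by simp
  have act: "\<phi> g y \<in> topspace X" if "g \<in> automorphisms F" "y \<in> topspace X" for g y
    using element_image[of g y] that by simp
  have act_mult: "\<phi> (g \<otimes>\<^bsub>?G\<^esub> h) y = \<phi> g (\<phi> h y)"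
    if "g \<in> automorphisms F" "h \<in> automorphisms F" "y \<in> topspace X" for g h y
    using composition_rule[of y g h] that by simp
  have act_one: "\<phi> \<one>\<^bsub>?G\<^esub> y = y" if "y \<in> topspace X" for y
    using fun_cong[OF id_eq_one, of y] that by simp

  \<comment> \<open>This packages the local data at a point: an element \<open>g\<close> moving it,
    two sets without an infinite independence set, and a finite \<open>A\<close> and an open
    \<open>O'\<close> on which the action is controlled.\<close>
  define good where "good g A O' V V' \<longleftrightarrow> g \<in> automorphisms F \<and> finite A \<and> A \<subseteq> universe F \<and> openin X O' \<and>
     \<not> (\<exists>I. infinite I \<and> independence_set ?G X \<phi> V V' I) \<and>
     (\<forall>v\<in>automorphisms F. \<forall>z\<in>O'. (\<forall>a\<in>A. v a = a) \<longrightarrow> \<phi> v z \<in> V \<and> \<phi> v (\<phi> g z) \<in> V')"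
    for g A O' V V'
  have "\<exists>g A O' V V'. good g A O' V V' \<and> y \<in> O'" if y: "y \<in> topspace X" for y
  proof -
    obtain g where g: "g \<in> automorphisms F" "\<phi> g y \<noteq> y"
      using moved[OF y] by blast
    then have "\<not> IT_pair ?G X \<phi> y (\<phi> g y)"
      using tame_flow_IT_pair[OF tame] by metis
    then obtain U U' where U: "neighbourhood X y U" "neighbourhood X (\<phi> g y) U'"
      and ind: "\<not> (\<exists>I. infinite I \<and> independence_set ?G X \<phi> U U' I)"
      using y act[OF g(1) y] unfolding IT_pair_def by blast
    \<comment> \<open>Continuity needs open sets, so it is applied to \<open>V\<close> and
      \<open>V'\<close>; the conclusions are then enlarged to \<open>U\<close> and
      \<open>U'\<close>, for which the absence of infinite independence sets is known.\<close>
    then obtain V V' where V: "openin X V" "y \<in> V" "V \<subseteq> U" "openin X V'" "\<phi> g y \<in> V'" "V' \<subseteq> U'"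
      unfolding neighbourhood_def by blast
    obtain A O1 where A: "finite A" "A \<subseteq> universe F" "openin X O1" "y \<in> O1"
        "\<forall>v\<in>automorphisms F. \<forall>z\<in>O1. (\<forall>a\<in>A. v a = a) \<longrightarrow> \<phi> v (\<phi> \<one>\<^bsub>?G\<^esub> z) \<in> V"
      using flow_nearly_fixed[OF fl one y V(1)] V(2) act_one[OF y] by auto
    obtain A' O2 where A': "finite A'" "A' \<subseteq> universe F" "openin X O2" "y \<in> O2"
        "\<forall>v\<in>automorphisms F. \<forall>z\<in>O2. (\<forall>a\<in>A'. v a = a) \<longrightarrow> \<phi> v (\<phi> g z) \<in> V'"
      using flow_nearly_fixed[OF fl g(1) y V(4,5)] by auto
    have near: "\<phi> v z \<in> U" "\<phi> v (\<phi> g z) \<in> U'"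
      if "v \<in> automorphisms F" "z \<in> O1 \<inter> O2" "\<forall>a\<in>A \<union> A'. v a = a" for v z
    proof -
      have "z \<in> topspace X"
        using openin_subset[OF A(3)] that(2) by blast
      then have "\<phi> v z \<in> V"
        using A(5) that act_one[of z] by fastforce
      then show "\<phi> v z \<in> U"
        using V(3) by blast
      have "\<phi> v (\<phi> g z) \<in> V'"
        using A'(5) that by blast
      then show "\<phi> v (\<phi> g z) \<in> U'"
        using V(6) by blast
    qed
    have "good g (A \<union> A') (O1 \<inter> O2) U U'"
      unfolding good_def
      by (intro conjI ballI impI near)
        (use g(1) A(1-3) A'(1-3) ind in \<open>assumption | simp add: openin_Int\<close>)+
    then show ?thesis
      using A(4) A'(4) by blast
  qed
  then obtain g A O' V V' where
    good: "\<And>y. y \<in> topspace X \<Longrightarrow> good (g y) (A y) (O' y) (V y) (V' y)"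
    and O': "\<And>y. y \<in> topspace X \<Longrightarrow> y \<in> O' y"
    by metis
  have openO: "openin X (O' y)" and A: "finite (A y)" "A y \<subseteq> universe F"
    and g: "g y \<in> automorphisms F"
    and noind: "\<not> (\<exists>I. infinite I \<and> independence_set ?G X \<phi> (V y) (V' y) I)"
    and near: "\<forall>v\<in>automorphisms F. \<forall>z\<in>O' y. (\<forall>a\<in>A y. v a = a) \<longrightarrow>
      \<phi> v z \<in> V y \<and> \<phi> v (\<phi> (g y) z) \<in> V' y"
    if "y \<in> topspace X" for y
    using good[OF that] unfolding good_def by iprover+
  obtain Y where Y: "finite Y" "Y \<subseteq> topspace X" "topspace X \<subseteq> (\<Union>y\<in>Y. O' y)"
  proof -
    have "\<exists>\<F>. finite \<F> \<and> \<F> \<subseteq> O' ` topspace X \<and> topspace X \<subseteq> \<Union>\<F>"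
      using X(2)[unfolded compact_space_alt, rule_format, of "O' ` topspace X"] openO O' by blast
    then show ?thesis
      using that by (metis finite_subset_image)
  qed
  obtain x where x: "x \<in> topspace X"
    using X(1) by blast
  \<comment> \<open>An empty structure has only the identity automorphism, which would fix
    \<open>x\<close>. The point \<open>a0\<close> then makes \<open>C\<close> nonempty.\<close>
  have "universe F \<noteq> {}"
  proof
    assume "universe F = {}"
    then have "h = \<one>\<^bsub>?G\<^esub>" if "h \<in> automorphisms F" for h
      using that one by (auto simp: automorphisms_def Bij_def)
    then show False
      using moved[OF x] act_one[OF x] by metis
  qed
  then obtain a0 where a0: "a0 \<in> universe F"
    by blast
  define D where "D = (\<Union>y\<in>Y. A y)"
  \<comment> \<open>The translates are included so that the inverse of each \<open>g y\<close> maps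
    \<open>A y\<close> into \<open>C\<close>, as \<open>switch\<close> requires.\<close>
  define C where "C = insert a0 (D \<union> (\<Union>y\<in>Y. (inv\<^bsub>?G\<^esub> g y) ` D))"
  have D: "finite D" "D \<subseteq> universe F"
    using Y(1,2) A unfolding D_def by blast+
  have C: "finite C" "C \<subseteq> universe F" "C \<noteq> {}"
    unfolding C_def using D Y(1,2) a0 automorphism_closed[OF inv[OF g]] by auto
  obtain u :: "nat \<Rightarrow> 'a \<Rightarrow> 'a" where u: "inj u" "range u \<subseteq> automorphisms F"
    and switch: "\<forall>g A s. g \<in> automorphisms F \<and> A \<subseteq> C \<and> g ` A \<subseteq> C \<longrightarrow>
      (\<exists>k\<in>automorphisms F. \<forall>n. \<forall>a\<in>A. k (u n a) = u n (if s n then g a else a))"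
    using independent_copies[OF assms(1-4) C] by (elim exE conjE) (rule that)
  then have u_aut: "u n \<in> automorphisms F" for n
    by blast
  have "\<exists>y\<in>Y. \<phi> (inv\<^bsub>?G\<^esub> u n) x \<in> O' y" for n
    using Y(3) act[OF inv[OF u_aut] x] by blast
  then obtain i where i: "\<And>n. i n \<in> Y" "\<And>n. \<phi> (inv\<^bsub>?G\<^esub> u n) x \<in> O' (i n)"
    by metis
  have "finite (range i)"
    using i(1) Y(1) by (meson finite_subset image_subsetI)
  \<comment> \<open>The finite cover is indexed by \<open>Y\<close>, so one member contains
    infinitely many of the points; only these indices are kept in \<open>N\<close>.\<close>
  then obtain n0 where inf: "infinite {n. i n = i n0}"
    using pigeonhole_infinite[of UNIV i] by auto
  define y where "y = i n0"
  define N where "N = {n. i n = y}"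
  have yY: "y \<in> Y" and yX: "y \<in> topspace X"
    using i(1) Y(2) unfolding y_def by blast+
  let ?I = "(\<lambda>n. inv\<^bsub>?G\<^esub> u n) ` N"
  have "inj (\<lambda>n. inv\<^bsub>?G\<^esub> u n)"
  proof (rule injI)
    fix n l assume "inv\<^bsub>?G\<^esub> u n = inv\<^bsub>?G\<^esub> u l"
    then have "u n = u l"
      by (metis carrier_aut_group inv_inv u_aut)
    then show "n = l"
      using u(1) by (simp add: inj_eq)
  qed
  then have "infinite ?I"
    using inf by (simp add: N_def y_def finite_image_iff inj_on_subset)
  moreover have "independence_set ?G X \<phi> (V y) (V' y) ?I"
    unfolding independence_set_def
  proof (intro conjI allI impI)
    show "?I \<subseteq> carrier ?G"
      using inv u_aut by auto
    fix J and \<sigma> :: "('a \<Rightarrow> 'a) \<Rightarrow> bool" assume J: "finite J \<and> J \<subseteq> ?I"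
    \<comment> \<open>The pattern is prescribed for all \<open>n\<close> at once, so the witness
      \<open>?z\<close> below serves every finite \<open>J\<close>.\<close>
    define s where "s n = \<sigma> (inv\<^bsub>?G\<^esub> u n)" for n
    let ?g' = "inv\<^bsub>?G\<^esub> g y"
    have gy: "g y \<in> automorphisms F" and g': "?g' \<in> automorphisms F"
      using g[OF yX] inv by auto
    have AD: "A y \<subseteq> D" "A y \<subseteq> C" "?g' ` A y \<subseteq> C"
      using yY unfolding D_def C_def by blast+
    then have AF: "A y \<subseteq> universe F"
      using C(2) by blast
    obtain k where k: "k \<in> automorphisms F"
        "\<And>n a. a \<in> A y \<Longrightarrow> k (u n a) = u n (if s n then ?g' a else a)"
      using switch[rule_format, of ?g' "A y" s] g' AD(2,3) by blast
    let ?z = "\<phi> (inv\<^bsub>?G\<^esub> k) x"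
    have z: "?z \<in> topspace X"
      using act inv k(1) x by blast
    have fixes_inv: "(inv\<^bsub>?G\<^esub> w) a = a" if "w \<in> automorphisms F" "w a = a" "a \<in> universe F" for w a
      using aut_group_inv_apply[OF that(1,3)] that(2) by simp
    have pattern: "\<phi> (inv\<^bsub>?G\<^esub> u n) ?z \<in> (if s n then V' y else V y)" if n: "n \<in> N" for n
    proof -
      let ?u = "u n" and ?u' = "inv\<^bsub>?G\<^esub> u n" and ?k' = "inv\<^bsub>?G\<^esub> k"
      \<comment> \<open>On \<open>A y\<close> this conjugate of \<open>k\<close> acts as the
        identity or as the inverse of \<open>g y\<close>, according to \<open>s n\<close>, while its
        inverse moves \<open>\<phi> ?u' x\<close> to \<open>\<phi> ?u' ?z\<close>.\<close>
      let ?w = "?u' \<otimes>\<^bsub>?G\<^esub> (k \<otimes>\<^bsub>?G\<^esub> ?u)"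
      have near_x: "\<phi> ?u' x \<in> O' y"
        using i(2)[of n] n by (simp add: N_def)
      note closed = u_aut[of n] inv[OF u_aut[of n]] k(1) inv[OF k(1)]
      note uc = closed[folded carrier_aut_group]
      have w: "?w \<in> automorphisms F"
        using closed mult by blast
      have inv_w: "inv\<^bsub>?G\<^esub> ?w = ?u' \<otimes>\<^bsub>?G\<^esub> ?k' \<otimes>\<^bsub>?G\<^esub> ?u"
        using uc by (simp add: inv_mult_group m_assoc del: carrier_aut_group)
      have w_apply: "?w a = (if s n then ?g' a else a)" if a: "a \<in> A y" for a
      proof -
        have "a \<in> universe F" "(if s n then ?g' a else a) \<in> universe F"
          using a AF automorphism_closed[OF g'] by auto
        then show ?thesis
          using closed mult k(2)[OF a, of n] by (simp add: aut_group_mult_apply aut_group_inv_apply)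
      qed
      have moves: "\<phi> (inv\<^bsub>?G\<^esub> ?w) (\<phi> ?u' x) = \<phi> ?u' ?z"
      proof -
        have "\<phi> (inv\<^bsub>?G\<^esub> ?w) (\<phi> ?u' x) = \<phi> (inv\<^bsub>?G\<^esub> ?w \<otimes>\<^bsub>?G\<^esub> ?u') x"
          using act_mult inv[OF w] closed x by simp
        also have "inv\<^bsub>?G\<^esub> ?w \<otimes>\<^bsub>?G\<^esub> ?u' = ?u' \<otimes>\<^bsub>?G\<^esub> ?k'"
          unfolding inv_w using uc by (simp add: m_assoc del: carrier_aut_group)
        finally show ?thesis
          using act_mult closed x by simp
      qed
      show ?thesis
      proof (cases "s n")
        case False
        have "(inv\<^bsub>?G\<^esub> ?w) a = a" if "a \<in> A y" for a
          using fixes_inv[OF w] w_apply[OF that] False AF that by auto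
        then show ?thesis
          using near[OF yX, rule_format, OF inv[OF w] near_x] moves False by simp
      next
        case True
        \<comment> \<open>Here \<open>?w\<close> agrees with the inverse of \<open>g y\<close> on
          \<open>A y\<close>, so \<open>?v\<close> fixes \<open>A y\<close> pointwise. Since
          \<open>inv ?w\<close> equals \<open>inv ?v\<close> times \<open>g y\<close>, the second
          clause of \<open>near\<close> gives membership in \<open>V' y\<close>.\<close>
        let ?v = "g y \<otimes>\<^bsub>?G\<^esub> ?w"
        have v: "?v \<in> automorphisms F"
          using mult gy w by blast
        have "?v a = a" if a: "a \<in> A y" for a
        proof -
          have aF: "a \<in> universe F"
            using a AF by blast
          have "?v a = g y (?g' a)"
            using aut_group_mult_apply[OF gy w aF] w_apply[OF a] True by simp
          also have "\<dots> = a"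
            using aut_group_inv_apply[OF g' aF] gy inv_inv[of "g y"] by simp
          finally show ?thesis .
        qed
        then have "\<phi> (inv\<^bsub>?G\<^esub> ?v) (\<phi> (g y) (\<phi> ?u' x)) \<in> V' y"
          using near[OF yX, rule_format, OF inv[OF v] near_x] fixes_inv[OF v] AF by blast
        moreover have "\<phi> (inv\<^bsub>?G\<^esub> ?v) (\<phi> (g y) (\<phi> ?u' x)) = \<phi> (inv\<^bsub>?G\<^esub> ?w) (\<phi> ?u' x)"
        proof -
          have "g y \<in> carrier ?G" "?w \<in> carrier ?G"
            using gy w by simp_all
          then have "inv\<^bsub>?G\<^esub> ?v \<otimes>\<^bsub>?G\<^esub> g y = inv\<^bsub>?G\<^esub> ?w"
            by (metis inv_closed inv_mult_group inv_solve_right' m_closed inv_inv)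
          then show ?thesis
            using act_mult[OF inv[OF v] gy act[OF closed(2) x]] by simp
        qed
        ultimately show ?thesis
          using moves True by simp
      qed
    qed
    \<comment> \<open>With \<open>j\<close> the inverse of \<open>u n\<close>, membership of
      \<open>?z\<close> in the translate by \<open>inv j\<close> means that
      \<open>\<phi> j ?z\<close> lies in the prescribed set, which is
      \<open>pattern\<close>.\<close>
    have "?z \<in> \<phi> (inv\<^bsub>?G\<^esub> j) ` (if \<sigma> j then V' y else V y)" if "j \<in> J" for j
    proof -
      obtain n where n: "n \<in> N" "j = inv\<^bsub>?G\<^esub> u n"
        using J \<open>j \<in> J\<close> by auto
      then have j: "j \<in> automorphisms F"
        using inv u_aut by simp
      have "\<phi> (inv\<^bsub>?G\<^esub> j) (\<phi> j ?z) = ?z"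
        using act_mult[OF inv[OF j] j z] act_one[OF z] j by simp
      moreover have "\<phi> j ?z \<in> (if \<sigma> j then V' y else V y)"
        using pattern[OF n(1)] n(2) by (simp add: s_def)
      ultimately show ?thesis
        by (metis image_eqI)
    qed
    then show "topspace X \<inter> (\<Inter>j\<in>J. \<phi> (inv\<^bsub>?G\<^esub> j) ` (if \<sigma> j then V' y else V y)) \<noteq> {}"
      using z by blast
  qed
  ultimately show False
    using noind[OF yX] by blast
qed

section \<open>Minimal flows and the universal minimal tame flow\<close>

text \<open>In a Hausdorff space a fixed point forms a closed, nonempty invariant set, and
  minimality leaves room for no other.\<close>

lemma minimal_flow_fixed_point:
  assumes "minimal_flow G T X \<phi>" "x \<in> topspace X" "\<forall>g\<in>carrier G. \<phi> g x = x"
  shows "topspace X = {x}"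
proof -
  have "closedin X {x}"
    using assms(1,2) by (simp add: minimal_flow_def flow_def closedin_Hausdorff_singleton)
  then show ?thesis
    using assms(1,3) unfolding minimal_flow_def by (metis image_empty image_insert insert_not_empty subset_refl)
qed

text \<open>This supplies the candidate for the universal minimal tame flow. The action is by
  \<open>restrict id {x}\<close> because elements of \<open>BijGroup\<close> are
  extensional.\<close>

lemma singleton_minimal_tame_flow:
  fixes x :: 'x
  assumes "group G"
  defines "X \<equiv> discrete_topology {x}" and "\<phi> \<equiv> \<lambda>g. restrict id {x}"
  shows "minimal_flow G T X \<phi>" "tame_flow G T X \<phi>"
proof -
  have "restrict id {x} = \<one>\<^bsub>BijGroup {x}\<^esub>"
    by (auto simp: BijGroup_def)
  moreover have "\<phi> \<in> hom G (BijGroup {x})"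
    using group.is_monoid[OF group_BijGroup[of "{x}"]] monoid.one_closed monoid.l_one
    by (fastforce simp: hom_def \<phi>_def calculation)
  ultimately have "group_action G {x} \<phi>"
    using assms(1) group_BijGroup
    by (simp add: group_action_def group_hom_def group_hom_axioms_def)
  moreover have "continuous_map (prod_topology T X) X (\<lambda>(g, y). \<phi> g y)"
    by (rule continuous_map_eq[of _ _ "\<lambda>_. x"]) (auto simp: X_def \<phi>_def)
  ultimately have fl: "flow G T X \<phi>"
    by (simp add: flow_def X_def compact_space_discrete_topology Hausdorff_space_discrete_topology)
  show "minimal_flow G T X \<phi>"
    using fl by (auto simp: minimal_flow_def X_def)
  show "tame_flow G T X \<phi>"
    using fl by (auto simp: tame_flow_def IT_pair_def X_def)
qed

text \<open>The existence clause ensures that the final clause, on the singleton, is not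
  vacuous.\<close>

theorem theorem3p12:
  fixes ar :: "'r \<Rightarrow> nat"
    and F :: "('a, 'r) relstruct"
  assumes "fraisse_structure ar F"
    and "henson_property ar F"
    and "hrushovski_property ar F"
    and "free_joint_embedding ar F"
  shows "(\<forall>(X :: 'x topology) \<phi>.
            tame_flow (aut_group F) (aut_topology F) X \<phi> \<longrightarrow>
            (\<exists>x \<in> topspace X. \<forall>g \<in> carrier (aut_group F). \<phi> g x = x)) \<and>
         (\<exists>(X :: 'x topology) \<phi>.
            universal_minimal_tame_flow TYPE('y) (aut_group F) (aut_topology F) X \<phi>) \<and>
         (\<forall>(X :: 'x topology) \<phi>.
            universal_minimal_tame_flow TYPE('y) (aut_group F) (aut_topology F) X \<phi> \<longrightarrow>
            (\<exists>x. topspace X = {x}))"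
proof (intro conjI allI impI)
  fix X :: "'x topology" and \<phi>
  assume "tame_flow (aut_group F) (aut_topology F) X \<phi>"
  then show "\<exists>x \<in> topspace X. \<forall>g \<in> carrier (aut_group F). \<phi> g x = x"
    using tame_flow_fixed_point[OF assms] by simp
next
  fix X :: "'x topology" and \<phi>
  assume "universal_minimal_tame_flow TYPE('y) (aut_group F) (aut_topology F) X \<phi>"
  then have "minimal_flow (aut_group F) (aut_topology F) X \<phi>"
      "tame_flow (aut_group F) (aut_topology F) X \<phi>"
    by (auto simp: universal_minimal_tame_flow_def)
  then show "\<exists>x. topspace X = {x}"
    using tame_flow_fixed_point[OF assms] minimal_flow_fixed_point by fastforce
next
  \<comment> \<open>The value \<open>undefined\<close> only provides a point of the type. Every
    competing minimal tame flow has a fixed point and hence is a single point, so a constant map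
    exhibits it as an image.\<close>
  let ?X = "discrete_topology {undefined} :: 'x topology"
    and ?\<phi> = "\<lambda>g :: 'a \<Rightarrow> 'a. restrict id {undefined :: 'x}"
  have "flow_image (aut_group F) ?X ?\<phi> Y \<psi>"
    if Y: "minimal_flow (aut_group F) (aut_topology F) Y \<psi>" "tame_flow (aut_group F) (aut_topology F) Y \<psi>"
    for Y :: "'y topology" and \<psi>
  proof -
    obtain y where y: "y \<in> topspace Y" "\<forall>g\<in>automorphisms F. \<psi> g y = y"
      using tame_flow_fixed_point[OF assms Y(2)] by blast
    then have "topspace Y = {y}"
      using minimal_flow_fixed_point[OF Y(1)] by simp
    then show ?thesis
      unfolding flow_image_def using y by (intro exI[of _ "\<lambda>_. y"]) auto
  qed
  then have "universal_minimal_tame_flow TYPE('y) (aut_group F) (aut_topology F) ?X ?\<phi>"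
    using singleton_minimal_tame_flow[OF group_aut_group]
    by (auto simp: universal_minimal_tame_flow_def)
  then show "\<exists>(X :: 'x topology) \<phi>.
      universal_minimal_tame_flow TYPE('y) (aut_group F) (aut_topology F) X \<phi>"
    by blast
qed

end
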